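(* Assume the Continuum Hypothesis. Then every productively Lindelöf sequential $T_3$ space $X$ is finitely powerfully Hurewicz, i.e., $X^k$ is Hurewicz for every positive integer $k$.
   Context: A topological space is productively Lindelöf if its product with every Lindelöf space is Lindelöf. A point-cofinite cover of a space is an infinite open cover such that each point belongs to all but finitely many members of the cover. A space $Y$ is Hurewicz if for each sequence $\{\mathcal{U}_n\}_{n<\omega}$ of open covers of $Y$ without finite subcovers there are finite $\mathcal{F}_n\subseteq\mathcal{U}_n$ such that $\{\bigcup\mathcal{F}_n : n<\omega\}$ is a point-cofinite cover of $Y$. Finite powers carry the product topology. *)

theory Defs
  imports "HOL-Analysis.Analysis" "HOL-Library.Equipollence"
begin

definition CH :: bool where
  "CH \<longleftrightarrow> (\<forall>A::real set. countable A \<or> A \<approx> (UNIV::real set))"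

definition sequentially_closedin :: "'a topology \<Rightarrow> 'a set \<Rightarrow> bool" where
  "sequentially_closedin X A \<longleftrightarrow> A \<subseteq> topspace X \<and>
     (\<forall>f x. (\<forall>n. f n \<in> A) \<longrightarrow> limitin X f x sequentially \<longrightarrow> x \<in> A)"

definition sequential_space :: "'a topology \<Rightarrow> bool" where
  "sequential_space X \<longleftrightarrow> (\<forall>A. sequentially_closedin X A \<longrightarrow> closedin X A)"

definition T3_space :: "'a topology \<Rightarrow> bool" where
  "T3_space X \<longleftrightarrow> regular_space X \<and> t1_space X"

definition productively_Lindelof :: "'b itself \<Rightarrow> 'a topology \<Rightarrow> bool" where
  "productively_Lindelof (_::'b itself) X \<longleftrightarrow>
     (\<forall>Y::'b topology. Lindelof_space Y \<longrightarrow> Lindelof_space (prod_topology X Y))"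

definition open_cover :: "'a topology \<Rightarrow> 'a set set \<Rightarrow> bool" where
  "open_cover X U \<longleftrightarrow> (\<forall>u\<in>U. openin X u) \<and> topspace X \<subseteq> \<Union>U"

definition has_finite_subcover :: "'a topology \<Rightarrow> 'a set set \<Rightarrow> bool" where
  "has_finite_subcover X U \<longleftrightarrow> (\<exists>F. F \<subseteq> U \<and> finite F \<and> topspace X \<subseteq> \<Union>F)"

definition point_cofinite_cover :: "'a topology \<Rightarrow> 'a set set \<Rightarrow> bool" where
  "point_cofinite_cover X V \<longleftrightarrow> infinite V \<and> open_cover X V \<and>
     (\<forall>x\<in>topspace X. finite {v\<in>V. x \<notin> v})"

definition Hurewicz_space :: "'a topology \<Rightarrow> bool" where
  "Hurewicz_space X \<longleftrightarrow>
     (\<forall>U::nat \<Rightarrow> 'a set set.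
        (\<forall>n. open_cover X (U n) \<and> \<not> has_finite_subcover X (U n)) \<longrightarrow>
        (\<exists>F::nat \<Rightarrow> 'a set set. (\<forall>n. F n \<subseteq> U n \<and> finite (F n)) \<and>
            point_cofinite_cover X (range (\<lambda>n. \<Union>(F n)))))"

definition power_space :: "'a topology \<Rightarrow> nat \<Rightarrow> (nat \<Rightarrow> 'a) topology" where
  "power_space X k = product_topology (\<lambda>_. X) {..<k}"

end

theory Submission
  imports Defs
begin

text \<open>
  A product \<open>X \<times> (X\<^sup>k \<times> Y)\<close> shows inductively that every power \<open>Z = X\<^sup>k\<close> of a productively
  Lindelof space is productively Lindelof. As \<open>Z\<close> is regular and Lindelof, hence normal, a sequence
  of open covers can be refined by countable covers with cozero sets, and the functions involved
  give one map \<open>f\<close> from \<open>Z\<close> into a Hilbert cube \<open>K\<close>. If \<open>M = f(Z)\<close> is \<open>\<sigma>\<close>-compact, the required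
  finite subfamilies can be read off the compact pieces. Otherwise CH provides an uncountable
  \<open>S \<subseteq> M\<close> that meets every compact subset of \<open>M\<close> in a countable set. Following Michael, let
  \<open>S \<union> (K - M)\<close> carry the topology in which the points of \<open>S\<close> are isolated and the points of
  \<open>K - M\<close> keep their usual neighbourhoods; this space is Lindelof, but its product with \<open>M\<close> is not,
  since it contains the diagonal of \<open>S\<close> as a closed discrete subset.
\<close>

section \<open>Concentrated sets under CH\<close>

text \<open>Proper initial segments of the cardinal order on the reals are strictly smaller than the
  continuum, hence countable under CH. Removing \<open>Id\<close> makes the order strict, as
  well-founded recursion requires.\<close>

lemma CH_well_order:
  assumes "CH"
  obtains R :: "(real \<times> real) set"
  where "wf R" "\<And>a b. a \<noteq> b \<Longrightarrow> (a, b) \<in> R \<or> (b, a) \<in> R" "\<And>a. countable {b. (b, a) \<in> R}"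
proof
  let ?r = "card_of (UNIV :: real set)"
  have wo: "well_order_on UNIV ?r" and co: "Card_order ?r"
    by (simp_all add: card_of_well_order_on card_of_Card_order)
  then show "wf (?r - Id)"
    by (simp add: well_order_on_def)
  show "(a, b) \<in> ?r - Id \<or> (b, a) \<in> ?r - Id" if "a \<noteq> b" for a b :: real
    using wo that by (auto simp: well_order_on_def linear_order_on_def total_on_def)
  fix a :: real
  have seg: "{b. (b, a) \<in> ?r - Id} = underS ?r a"
    by (auto simp: underS_def)
  have "a \<in> Field ?r"
    by (simp add: Field_card_of)
  then have "\<not> underS ?r a \<approx> (UNIV :: real set)"
    using card_of_underS[OF co] not_ordLess_ordIso by (auto simp: eqpoll_iff_card_of_ordIso)
  then show "countable {b. (b, a) \<in> ?r - Id}"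
    using assms unfolding CH_def seg by blast
qed

text \<open>A Luzin-type recursion: stage \<open>a\<close> picks a point of \<open>M\<close> off the
  earlier points and off the members of \<open>\<C>\<close> listed up to \<open>a\<close>, which
  \<open>ncov\<close> permits. A set listed at stage \<open>b\<close> can then contain only points
  picked before \<open>b\<close>, and these are countably many.\<close>

lemma CH_concentrated_set:
  assumes "CH" and small: "\<C> \<lesssim> (UNIV :: real set)"
    and sing: "\<And>x. x \<in> M \<Longrightarrow> {x} \<in> \<C>"
    and ncov: "\<And>\<D>. countable \<D> \<Longrightarrow> \<D> \<subseteq> \<C> \<Longrightarrow> \<not> M \<subseteq> \<Union>\<D>"
  shows "\<exists>S\<subseteq>M. uncountable S \<and> (\<forall>C\<in>\<C>. countable (S \<inter> C))"
proof -
  obtain R :: "(real \<times> real) set" where R: "wf R"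
    "\<And>a b. a \<noteq> b \<Longrightarrow> (a, b) \<in> R \<or> (b, a) \<in> R" "\<And>a. countable {b. (b, a) \<in> R}"
    using CH_well_order[OF \<open>CH\<close>] by metis
  obtain g :: "real \<Rightarrow> _" where g: "\<C> \<subseteq> range g"
    using small by (auto simp: lepoll_iff)
  \<comment> \<open>Admissibility of \<open>x\<close> at stage \<open>a\<close>. The case
    \<open>b = a\<close> is included so that only strictly earlier points can fall into
    \<open>g b\<close>; the guard \<open>g b \<in> \<C>\<close> is there because
    \<open>range g\<close> may exceed \<open>\<C>\<close>.\<close>
  define P where "P f a x \<longleftrightarrow> x \<in> M \<and> (\<forall>b. (b, a) \<in> R \<longrightarrow> x \<noteq> f b) \<and>
    (\<forall>b. (b, a) \<in> R \<or> b = a \<longrightarrow> g b \<in> \<C> \<longrightarrow> x \<notin> g b)" for f a x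
  have "\<exists>f. \<forall>a. P f a (f a)"
  proof (rule dependent_wf_choice[OF R(1)])
    show "P f a r = P h a r" if "\<And>z. (z, a) \<in> R \<Longrightarrow> f z = h z" for f h a r
      using that by (auto simp: P_def)
    show "\<exists>r. P f a r" if f: "\<And>b. (b, a) \<in> R \<Longrightarrow> P f b (f b)" for a f
    proof -
      let ?I = "{b. (b, a) \<in> R}"
      \<comment> \<open>By \<open>sing\<close> the earlier points enter as members of
        \<open>\<C>\<close>, so one countable subfamily collects everything to be avoided.\<close>
      let ?D = "((\<lambda>b. {f b}) ` ?I \<union> g ` insert a ?I) \<inter> \<C>"
      have "countable ?D"
        using R(3)[of a] by (intro countable_Int1 countable_Un countable_image countable_insert)
      then obtain x where "x \<in> M" "x \<notin> \<Union>?D"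
        using ncov[of ?D] by blast
      moreover have "{f b} \<in> \<C>" if "b \<in> ?I" for b
        using f[of b] that sing by (auto simp: P_def)
      ultimately have "P f a x"
        unfolding P_def by blast
      then show ?thesis ..
    qed
  qed
  then obtain f where f: "\<And>a. P f a (f a)"
    by blast
  have "inj f"
    by (rule injI) (use f R(2) in \<open>metis P_def\<close>)
  show ?thesis
  proof (intro exI[of _ "range f"] conjI ballI)
    show "range f \<subseteq> M"
      using f by (auto simp: P_def)
    show "uncountable (range f)"
      using \<open>inj f\<close> countable_image_inj_on uncountable_UNIV_real by blast
    fix C assume "C \<in> \<C>"
    then obtain b where b: "C = g b"
      using g by blast
    have "range f \<inter> C \<subseteq> f ` {a. (a, b) \<in> R}"
    proof clarify
      fix a assume "f a \<in> C"
      then show "f a \<in> f ` {a. (a, b) \<in> R}"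
        using f[of a] R(2)[of a b] \<open>C \<in> \<C>\<close> b by (auto simp: P_def)
    qed
    then show "countable (range f \<inter> C)"
      by (rule countable_subset) (intro countable_image R(3))
  qed
qed

section \<open>Cardinality of second countable spaces\<close>

text \<open>A closed set is determined by the indices of the basic open sets that miss it. Hence the
  compact subsets of a second countable Hausdorff space can be listed along the reals.\<close>

lemma closed_sets_lepoll_real:
  "{C :: 'b::second_countable_topology set. closed C} \<lesssim> (UNIV :: real set)"
proof -
  obtain B :: "'b set set" where B: "countable B" "topological_basis B"
    using ex_countable_basis by blast
  obtain e :: "nat \<Rightarrow> 'b set" where e: "B \<subseteq> range e"
    using subset_range_from_nat_into[OF B(1)] by blast
  let ?h = "\<lambda>C :: 'b set. {n. e n \<in> B \<and> e n \<inter> C = {}}"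
  have eq: "C = - (\<Union>n\<in>?h C. e n)" if "closed C" for C
  proof -
    have "\<exists>n. e n \<in> B \<and> e n \<inter> C = {} \<and> x \<in> e n" if "x \<notin> C" for x
    proof -
      obtain b where "b \<in> B" "x \<in> b" "b \<subseteq> - C"
        using topological_basisE[OF B(2), of "- C" x] \<open>closed C\<close> \<open>x \<notin> C\<close> by auto
      moreover from \<open>b \<in> B\<close> obtain n where "b = e n"
        using e by blast
      ultimately show ?thesis
        by blast
    qed
    then show ?thesis
      by auto
  qed
  have "inj_on ?h {C. closed C}"
  proof (rule inj_onI)
    fix C D assume CD: "C \<in> {C. closed C}" "D \<in> {C. closed C}" "?h C = ?h D"
    then have "C = - (\<Union>n\<in>?h C. e n)"
      by (intro eq) auto
    also have "\<dots> = - (\<Union>n\<in>?h D. e n)"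
      by (simp only: CD(3))
    also have "\<dots> = D"
      using CD by (intro eq[symmetric]) auto
    finally show "C = D" .
  qed
  then have "{C :: 'b set. closed C} \<lesssim> (UNIV :: nat set set)"
    by (auto simp: lepoll_def)
  then show ?thesis
    using lepoll_trans2 nat_sets_eqpoll_reals by blast
qed

lemma UNIV_lepoll_real:
  "(UNIV :: 'b::{second_countable_topology, t1_space} set) \<lesssim> (UNIV :: real set)"
proof -
  have "(UNIV :: 'b set) \<lesssim> {C :: 'b set. closed C}"
    unfolding lepoll_def by (rule exI[of _ "\<lambda>x. {x}"]) (auto simp: inj_on_def)
  then show ?thesis
    using closed_sets_lepoll_real lepoll_trans by blast
qed

section \<open>Michael-type spaces\<close>

text \<open>An open set is the trace of an ordinary open \<open>V\<close> together with arbitrary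
  points of \<open>S\<close>. With the irrationals as \<open>S\<close> and the rationals as
  \<open>N\<close> this is the Michael line.\<close>

definition michael_topology :: "'b::topological_space set \<Rightarrow> 'b set \<Rightarrow> 'b topology" where
  "michael_topology S N =
     topology (\<lambda>U. U \<subseteq> S \<union> N \<and> (\<exists>V. open V \<and> V \<inter> (S \<union> N) \<subseteq> U \<and> U \<subseteq> V \<union> S))"

lemma openin_michael_topology:
  "openin (michael_topology S N) U \<longleftrightarrow>
     U \<subseteq> S \<union> N \<and> (\<exists>V. open V \<and> V \<inter> (S \<union> N) \<subseteq> U \<and> U \<subseteq> V \<union> S)" (is "_ \<longleftrightarrow> ?P U")
proof -
  have "istopology ?P"
    unfolding istopology_def
  proof (intro conjI allI impI)
    fix U W assume "?P U" "?P W"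
    then obtain V1 V2 where V: "open V1" "V1 \<inter> (S \<union> N) \<subseteq> U" "U \<subseteq> V1 \<union> S"
      "open V2" "V2 \<inter> (S \<union> N) \<subseteq> W" "W \<subseteq> V2 \<union> S"
      by blast
    show "U \<inter> W \<subseteq> S \<union> N"
      using \<open>?P U\<close> by blast
    show "\<exists>V. open V \<and> V \<inter> (S \<union> N) \<subseteq> U \<inter> W \<and> U \<inter> W \<subseteq> V \<union> S"
      by (rule exI[of _ "V1 \<inter> V2"]) (use V in auto)
  next
    fix \<K> assume "\<forall>U\<in>\<K>. ?P U"
    then have "\<forall>U\<in>\<K>. \<exists>V. open V \<and> V \<inter> (S \<union> N) \<subseteq> U \<and> U \<subseteq> V \<union> S"
      by blast
    then obtain V where V: "\<And>U. U \<in> \<K> \<Longrightarrow> open (V U) \<and> V U \<inter> (S \<union> N) \<subseteq> U \<and> U \<subseteq> V U \<union> S"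
      by metis
    show "\<Union>\<K> \<subseteq> S \<union> N"
      using \<open>\<forall>U\<in>\<K>. ?P U\<close> by blast
    show "\<exists>V. open V \<and> V \<inter> (S \<union> N) \<subseteq> \<Union>\<K> \<and> \<Union>\<K> \<subseteq> V \<union> S"
      by (rule exI[of _ "\<Union>(V ` \<K>)"]) (use V in \<open>fastforce intro!: open_UN\<close>)
  qed
  then show ?thesis
    by (simp add: michael_topology_def)
qed

lemma topspace_michael_topology [simp]: "topspace (michael_topology S N) = S \<union> N"
proof -
  have "openin (michael_topology S N) (S \<union> N)"
    unfolding openin_michael_topology by (intro conjI exI[of _ UNIV]) auto
  then show ?thesis
    using openin_michael_topology[of S N] openin_topspace[of "michael_topology S N"] openin_subset
    by (metis subset_antisym)
qed

text \<open>The points of \<open>S\<close> outside a neighbourhood of \<open>K - M\<close> lie in a compact subset of \<open>M\<close>.\<close>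

lemma Lindelof_michael_topology:
  fixes K M :: "'b::second_countable_topology set"
  assumes "compact K" "M \<subseteq> K" "S \<subseteq> M"
    and cnt: "\<And>C. compact C \<Longrightarrow> C \<subseteq> M \<Longrightarrow> countable (S \<inter> C)"
  shows "Lindelof_space (michael_topology S (K - M))"
  unfolding Lindelof_space_alt
proof (intro allI impI, elim conjE)
  let ?Y = "S \<union> (K - M)"
  fix \<U> assume op: "\<forall>U\<in>\<U>. openin (michael_topology S (K - M)) U"
    and cov: "topspace (michael_topology S (K - M)) \<subseteq> \<Union>\<U>"
  have "\<forall>U\<in>\<U>. \<exists>V. open V \<and> V \<inter> ?Y \<subseteq> U \<and> U \<subseteq> V \<union> S"
    using op by (simp add: openin_michael_topology)
  then obtain V where V: "\<And>U. U \<in> \<U> \<Longrightarrow> open (V U)"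
    "\<And>U. U \<in> \<U> \<Longrightarrow> V U \<inter> ?Y \<subseteq> U" "\<And>U. U \<in> \<U> \<Longrightarrow> U \<subseteq> V U \<union> S"
    by metis
  \<comment> \<open>The ordinary topology is hereditarily Lindelof, so countably many
    \<open>V U\<close> have the same union as all of them. This union contains \<open>K - M\<close>,
    since a point outside \<open>S\<close> can lie in \<open>U\<close> only through
    \<open>V U\<close>.\<close>
  obtain \<V> where "\<V> \<subseteq> V ` \<U>" "countable \<V>" "\<Union>\<V> = \<Union>(V ` \<U>)"
    using Lindelof[of "V ` \<U>"] V(1) by blast
  then obtain \<U>0 where U0: "\<U>0 \<subseteq> \<U>" "countable \<U>0" "\<Union>(V ` \<U>0) = \<Union>(V ` \<U>)"
    by (metis countable_subset_image)
  let ?C = "K - \<Union>(V ` \<U>0)"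
  have "open (\<Union>(V ` \<U>0))"
    using U0(1) V(1) by auto
  then have "compact ?C"
    by (rule compact_diff[OF \<open>compact K\<close>])
  moreover have "?C \<subseteq> M"
  proof
    fix x assume x: "x \<in> ?C"
    show "x \<in> M"
    proof (rule ccontr)
      assume "x \<notin> M"
      then obtain U where "U \<in> \<U>" "x \<in> U"
        using x cov by auto
      then have "x \<in> V U"
        using V(3) \<open>S \<subseteq> M\<close> \<open>x \<notin> M\<close> by blast
      then show False
        using x U0(3) \<open>U \<in> \<U>\<close> by blast
    qed
  qed
  ultimately have "countable (S \<inter> ?C)"
    by (rule cnt)
  moreover have "\<forall>x\<in>S. \<exists>U. U \<in> \<U> \<and> x \<in> U"
    using cov by auto
  then obtain u where u: "\<And>x. x \<in> S \<Longrightarrow> u x \<in> \<U> \<and> x \<in> u x"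
    by metis
  ultimately have "countable (\<U>0 \<union> u ` (S \<inter> ?C))"
    using U0(2) by blast
  moreover have "\<U>0 \<union> u ` (S \<inter> ?C) \<subseteq> \<U>"
    using U0(1) u by blast
  moreover have "?Y \<subseteq> \<Union>(\<U>0 \<union> u ` (S \<inter> ?C))"
  proof
    fix x assume x: "x \<in> ?Y"
    show "x \<in> \<Union>(\<U>0 \<union> u ` (S \<inter> ?C))"
    proof (cases "x \<in> ?C")
      case True
      then show ?thesis
        using x u \<open>?C \<subseteq> M\<close> by blast
    next
      case False
      then obtain U where "U \<in> \<U>0" "x \<in> V U"
        using x \<open>S \<subseteq> M\<close> \<open>M \<subseteq> K\<close> by blast
      then show ?thesis
        using V(2) U0(1) x by blast
    qed
  qed
  ultimately show "\<exists>\<V>. countable \<V> \<and> \<V> \<subseteq> \<U> \<and> topspace (michael_topology S (K - M)) \<subseteq> \<Union>\<V>"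
    by (metis topspace_michael_topology)
qed

text \<open>In the cover built here a diagonal point \<open>(y, y)\<close> with
  \<open>y \<in> S\<close> lies in the slice \<open>M \<times> {y}\<close> and in no other member. A
  subcover therefore keeps all of the uncountably many slices.\<close>

lemma not_Lindelof_prod_michael_topology:
  fixes M :: "'b::t2_space set"
  assumes "S \<subseteq> M" "M \<inter> N = {}" "uncountable S"
  shows "\<not> Lindelof_space (prod_topology (top_of_set M) (michael_topology S N))"
proof
  let ?Y = "michael_topology S N"
  assume L: "Lindelof_space (prod_topology (top_of_set M) ?Y)"
  \<comment> \<open>Slices are open because points of \<open>S\<close> are isolated. Boxes over
    disjoint open sets miss the diagonal and catch each \<open>(m, z)\<close> with
    \<open>z \<notin> S\<close>, for then \<open>z \<in> N\<close> and so
    \<open>m \<noteq> z\<close>.\<close>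
  define \<U> where "\<U> = (\<lambda>y. M \<times> {y}) ` S"
  define \<W> where "\<W> = {(M \<inter> A) \<times> ((S \<union> N) \<inter> B) |A B. open A \<and> open B \<and> A \<inter> B = {}}"
  have "openin ?Y {y}" if "y \<in> S" for y
    unfolding openin_michael_topology using that by (intro conjI exI[of _ "{}"]) auto
  moreover have "openin ?Y ((S \<union> N) \<inter> B)" if "open B" for B
    unfolding openin_michael_topology using that by (intro conjI exI[of _ B]) auto
  moreover have "openin (top_of_set M) M"
    by (simp add: openin_subtopology_refl)
  ultimately have "\<forall>W\<in>\<U> \<union> \<W>. openin (prod_topology (top_of_set M) ?Y) W"
    unfolding \<U>_def \<W>_def by (auto simp: openin_prod_Times_iff openin_open_Int)
  moreover have "topspace (prod_topology (top_of_set M) ?Y) \<subseteq> \<Union>(\<U> \<union> \<W>)"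
  proof
    fix p assume "p \<in> topspace (prod_topology (top_of_set M) ?Y)"
    then obtain m z where p: "p = (m, z)" "m \<in> M" "z \<in> S \<union> N"
      by auto
    show "p \<in> \<Union>(\<U> \<union> \<W>)"
    proof (cases "z \<in> S")
      case True
      then show ?thesis
        using p by (auto simp: \<U>_def)
    next
      case False
      then have "m \<noteq> z"
        using p \<open>M \<inter> N = {}\<close> by blast
      then obtain A B where "open A" "open B" "m \<in> A" "z \<in> B" "A \<inter> B = {}"
        by (metis hausdorff)
      then have "(M \<inter> A) \<times> ((S \<union> N) \<inter> B) \<in> \<W>" "p \<in> (M \<inter> A) \<times> ((S \<union> N) \<inter> B)"
        using p by (auto simp: \<W>_def)
      then show ?thesis
        by blast
    qed
  qed
  ultimately obtain \<V> where V: "countable \<V>" "\<V> \<subseteq> \<U> \<union> \<W>"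
    "topspace (prod_topology (top_of_set M) ?Y) \<subseteq> \<Union>\<V>"
    using L unfolding Lindelof_space_alt by meson
  have "(\<lambda>y. M \<times> {y}) ` S \<subseteq> \<V>"
  proof clarify
    fix y assume "y \<in> S"
    then have "(y, y) \<in> topspace (prod_topology (top_of_set M) ?Y)"
      using \<open>S \<subseteq> M\<close> by auto
    then obtain W where "W \<in> \<V>" "(y, y) \<in> W"
      using V(3) by blast
    moreover have "W \<notin> \<W>"
      using \<open>(y, y) \<in> W\<close> unfolding \<W>_def by blast
    ultimately show "M \<times> {y} \<in> \<V>"
      using V(2) by (auto simp: \<U>_def)
  qed
  moreover have "inj_on (\<lambda>y. M \<times> {y}) S"
    using \<open>S \<subseteq> M\<close> by (intro inj_onI) blast
  ultimately have "countable S"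
    by (meson V(1) countable_image_inj_on countable_subset)
  with \<open>uncountable S\<close> show False ..
qed

section \<open>Sigma-compactness from products\<close>

text \<open>If the claim fails, the compact subsets of \<open>M\<close> form a family to which
  \<open>CH_concentrated_set\<close> applies. The Michael-type space over the resulting
  \<open>S\<close> lives on the same type \<open>'b\<close>, so \<open>prod\<close> covers it and is
  contradicted.\<close>

lemma CH_sigma_compact:
  fixes K M :: "'b::{second_countable_topology, t2_space} set"
  assumes "CH" "compact K" "M \<subseteq> K"
    and prod: "\<And>Y :: 'b topology. Lindelof_space Y \<Longrightarrow> Lindelof_space (prod_topology (top_of_set M) Y)"
  shows "\<exists>\<D>. countable \<D> \<and> (\<forall>C\<in>\<D>. compact C) \<and> \<Union>\<D> = M"
proof (rule ccontr)
  assume not: "\<not> ?thesis"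
  let ?\<C> = "{C. compact C \<and> C \<subseteq> M}"
  have "?\<C> \<lesssim> (UNIV :: real set)"
    by (rule lepoll_trans[OF subset_imp_lepoll closed_sets_lepoll_real])
      (auto intro: compact_imp_closed)
  moreover have "{x} \<in> ?\<C>" if "x \<in> M" for x
    using that by simp
  moreover have "\<not> M \<subseteq> \<Union>\<D>" if "countable \<D>" "\<D> \<subseteq> ?\<C>" for \<D>
  proof
    assume "M \<subseteq> \<Union>\<D>"
    then have "\<Union>\<D> = M"
      using that(2) by blast
    with not that show False
      by blast
  qed
  ultimately have "\<exists>S\<subseteq>M. uncountable S \<and> (\<forall>C\<in>?\<C>. countable (S \<inter> C))"
    by (rule CH_concentrated_set[OF \<open>CH\<close>])
  then obtain S where S: "S \<subseteq> M" "uncountable S" "\<forall>C\<in>?\<C>. countable (S \<inter> C)"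
    by (elim exE conjE)
  then have "Lindelof_space (michael_topology S (K - M))"
    using Lindelof_michael_topology[OF assms(2,3), of S] by simp
  with S(1,2) show False
    using not_Lindelof_prod_michael_topology[of S M "K - M"] prod by blast
qed

section \<open>Finite powers of productively Lindelof spaces\<close>

text \<open>\<open>productively_Lindelof\<close> tests only spaces on one fixed type. A space that
  is small enough has a homeomorphic copy on that type, and the product with the copy maps
  continuously onto the product with the original.\<close>

lemma productively_Lindelof_lepoll:
  fixes X :: "'a topology" and Y :: "'b topology"
  assumes X: "productively_Lindelof TYPE('c) X" and Y: "Lindelof_space Y"
    and small: "topspace Y \<lesssim> (UNIV :: 'c set)"
  shows "Lindelof_space (prod_topology X Y)"
proof -
  obtain f :: "'b \<Rightarrow> 'c" where f: "inj_on f (topspace Y)"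
    using small by (auto simp: lepoll_def)
  let ?g = "inv_into (topspace Y) f"
  \<comment> \<open>The copy of \<open>Y\<close> on the image of \<open>f\<close>. The map
    \<open>f\<close> is continuous into it because \<open>?g \<circ> f\<close> is the identity on
    \<open>topspace Y\<close>.\<close>
  let ?Z = "pullback_topology (f ` topspace Y) ?g Y"
  have top: "topspace ?Z = f ` topspace Y"
    using f by (auto simp: topspace_pullback_topology)
  have "continuous_map Y Y (?g \<circ> f)"
    by (rule continuous_map_eq[of _ _ id]) (use f in auto)
  then have "continuous_map Y ?Z f"
    by (rule continuous_map_pullback') auto
  then have "Lindelof_space ?Z"
    using Y top by (intro Lindelof_space_continuous_map_image[of Y ?Z f]) auto
  then have L: "Lindelof_space (prod_topology X ?Z)"
    using X by (simp add: productively_Lindelof_def)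
  have "continuous_map ?Z Y (id \<circ> ?g)"
    by (rule continuous_map_pullback) simp
  then have "continuous_map (prod_topology X ?Z) Y (?g \<circ> snd)"
    by (intro continuous_map_compose[OF continuous_map_snd]) (simp add: comp_def)
  then have c: "continuous_map (prod_topology X ?Z) (prod_topology X Y) (\<lambda>p. (fst p, ?g (snd p)))"
    by (intro continuous_map_pairedI continuous_map_fst) (simp add: comp_def)
  have "(\<lambda>p. (fst p, ?g (snd p))) ` topspace (prod_topology X ?Z) = topspace (prod_topology X Y)"
  proof -
    have "(x, y) \<in> (\<lambda>p. (fst p, ?g (snd p))) ` (topspace X \<times> f ` topspace Y)"
      if "x \<in> topspace X" "y \<in> topspace Y" for x y
      using that f by (intro image_eqI[of _ _ "(x, f y)"]) auto
    then show ?thesis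
      using f by (auto simp: top)
  qed
  with L c show ?thesis
    by (rule Lindelof_space_continuous_map_image)
qed

text \<open>An infinite cardinal equals its square. This preserves the size bound when a further
  factor \<open>X\<close> is added.\<close>

lemma Times_Pow_lepoll:
  assumes "infinite (UNIV :: 'a set)" "A \<lesssim> (UNIV :: 'a set)" "B \<lesssim> (UNIV :: 'a set set)"
  shows "A \<times> B \<lesssim> (UNIV :: 'a set set)"
proof -
  have "A \<times> B \<lesssim> (UNIV :: 'a set set) \<times> (UNIV :: 'a set set)"
    using assms lepoll_Pow_self[of "UNIV :: 'a set"] lepoll_trans
    by (intro times_lepoll_mono) auto
  also have "\<dots> \<approx> (UNIV :: 'a set set)"
    unfolding eqpoll_iff_card_of_ordIso
    using assms(1) by (intro card_of_Times_same_infinite) (simp add: Finite_Set.finite_set)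
  finally show ?thesis .
qed

text \<open>\<open>X \<times> (X^k \<times> Y)\<close> maps continuously onto
  \<open>X^(k+1) \<times> Y\<close>. The size bound is carried through the induction so that
  \<open>X^k \<times> Y\<close> is itself an admissible test space for \<open>X\<close>.\<close>

lemma Lindelof_prod_power_space:
  fixes X :: "'a topology"
  assumes X: "productively_Lindelof TYPE('a set) X" and "infinite (UNIV :: 'a set)"
    and Y: "Lindelof_space Y" "topspace Y \<lesssim> (UNIV :: 'a set set)"
  shows "Lindelof_space (prod_topology (power_space X k) Y)
    \<and> topspace (prod_topology (power_space X k) Y) \<lesssim> (UNIV :: 'a set set)"
proof (induction k)
  case 0
  \<comment> \<open>The empty power has one point, the function that is \<open>undefined\<close>
    everywhere.\<close>
  let ?f = "\<lambda>y. (\<lambda>_. undefined :: 'a, y)"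
  have top: "topspace (power_space X 0) = {\<lambda>_. undefined}"
    by (simp add: power_space_def)
  have "continuous_map Y (prod_topology (power_space X 0) Y) ?f"
    by (intro continuous_map_pairedI) (auto simp: top)
  then have "Lindelof_space (prod_topology (power_space X 0) Y)"
    by (rule Lindelof_space_continuous_map_image[OF Y(1)]) (auto simp: top)
  moreover have "topspace (prod_topology (power_space X 0) Y) \<lesssim> topspace Y"
    unfolding topspace_prod_topology top by (rule eqpoll_imp_lepoll[OF times_singleton_eqpoll])
  ultimately show ?case
    using Y(2) lepoll_trans by blast
next
  case (Suc k)
  let ?P = "prod_topology X (prod_topology (power_space X k) Y)"
  let ?Q = "prod_topology (power_space X (Suc k)) Y"
  let ?f = "\<lambda>(x, g, y). (g(k := x), y)"
  have c: "continuous_map ?P ?Q ?f"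
  proof -
    have "continuous_map ?P X (\<lambda>p. ((fst (snd p))(k := fst p)) i)" if "i < Suc k" for i
    proof (cases "i = k")
      case True
      then show ?thesis by (simp add: continuous_map_fst)
    next
      case False
      have "continuous_map (power_space X k) X (\<lambda>g. g i)"
        unfolding power_space_def using that False by (intro continuous_map_product_projection) auto
      then have "continuous_map ?P X (\<lambda>p. fst (snd p) i)"
        using continuous_map_compose[OF continuous_map_compose[OF continuous_map_snd continuous_map_fst]]
        by (fastforce simp: comp_def)
      then show ?thesis using False by simp
    qed
    moreover have "(\<lambda>p. (fst (snd p))(k := fst p)) \<in> topspace ?P \<rightarrow> extensional {..<Suc k}"
      by (auto simp: power_space_def PiE_def extensional_def)
    ultimately have "continuous_map ?P (power_space X (Suc k)) (\<lambda>p. (fst (snd p))(k := fst p))"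
      unfolding power_space_def[of X "Suc k"] continuous_map_componentwise by auto
    moreover have "continuous_map ?P Y (\<lambda>p. snd (snd p))"
      using continuous_map_compose[OF continuous_map_snd continuous_map_snd]
      by (fastforce simp: comp_def)
    ultimately show ?thesis
      by (simp add: case_prod_unfold continuous_map_pairedI)
  qed
  have im: "?f ` topspace ?P = topspace ?Q"
  proof
    show "?f ` topspace ?P \<subseteq> topspace ?Q"
      using c by (simp add: continuous_map_def Pi_iff image_subset_iff)
    show "topspace ?Q \<subseteq> ?f ` topspace ?P"
    proof
      fix q assume q: "q \<in> topspace ?Q"
      \<comment> \<open>Coordinate \<open>k\<close> is split off and reset to
        \<open>undefined\<close>, so that the rest is extensional on \<open>{..<k}\<close>.\<close>
      let ?p = "(fst q k, (fst q)(k := undefined), snd q)"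
      have "(fst q)(k := undefined) \<in> topspace (power_space X k)"
        unfolding power_space_def topspace_product_topology
        by (rule fun_upd_in_PiE) (use q in \<open>auto simp: power_space_def lessThan_Suc\<close>)
      then have "?p \<in> topspace ?P"
        using q by (auto simp: power_space_def)
      moreover have "q = ?f ?p"
        by simp
      ultimately show "q \<in> ?f ` topspace ?P"
        by (rule rev_image_eqI)
    qed
  qed
  have "Lindelof_space ?P"
    using productively_Lindelof_lepoll[OF X] Suc by blast
  then have "Lindelof_space ?Q"
    using c im by (rule Lindelof_space_continuous_map_image)
  moreover have "topspace ?P \<lesssim> (UNIV :: 'a set set)"
    unfolding topspace_prod_topology[of X] using Suc
    by (intro Times_Pow_lepoll assms(2) subset_imp_lepoll) auto
  then have "topspace ?Q \<lesssim> (UNIV :: 'a set set)"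
    using image_lepoll[of ?f "topspace ?P"] unfolding im by (rule lepoll_trans[rotated])
  ultimately show ?case ..
qed

section \<open>The Hurewicz property\<close>

text \<open>A point-cofinite cover is a set, so repetitions among the unions could make it finite;
  the absence of finite subcovers excludes this.\<close>

lemma Hurewicz_spaceI:
  assumes "\<And>U. (\<And>n. open_cover Z (U n)) \<Longrightarrow> (\<And>n. \<not> has_finite_subcover Z (U n)) \<Longrightarrow>
    \<exists>F. (\<forall>n. F n \<subseteq> U n \<and> finite (F n)) \<and> (\<forall>z\<in>topspace Z. \<forall>\<^sub>F n in sequentially. z \<in> \<Union>(F n))"
  shows "Hurewicz_space Z"
  unfolding Hurewicz_space_def
proof (intro allI impI)
  fix U :: "nat \<Rightarrow> 'a set set"
  assume U: "\<forall>n. open_cover Z (U n) \<and> \<not> has_finite_subcover Z (U n)"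
  then obtain F where F: "\<And>n. F n \<subseteq> U n" "\<And>n. finite (F n)"
    "\<And>z. z \<in> topspace Z \<Longrightarrow> \<forall>\<^sub>F n in sequentially. z \<in> \<Union>(F n)"
    using assms[of U] by blast
  let ?V = "\<lambda>n. \<Union>(F n)"
  have fin: "finite {n. z \<notin> ?V n}" if "z \<in> topspace Z" for z
    using F(3)[OF that] by (simp add: cofinite_eq_sequentially[symmetric] eventually_cofinite)
  have miss: "\<exists>z\<in>topspace Z. z \<notin> ?V n" for n
  proof (rule ccontr)
    assume "\<not> ?thesis"
    then have "topspace Z \<subseteq> ?V n"
      by blast
    then show False
      using U F(1,2)[of n] unfolding has_finite_subcover_def by blast
  qed
  \<comment> \<open>Otherwise one union \<open>?V m\<close> recurs for infinitely many indices, and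
    a point outside it is missed infinitely often.\<close>
  have "infinite (range ?V)"
  proof
    assume "finite (range ?V)"
    then obtain m where "infinite {n. ?V n = ?V m}"
      using pigeonhole_infinite[of "UNIV :: nat set" ?V] by auto
    moreover obtain z where "z \<in> topspace Z" "z \<notin> ?V m"
      using miss by blast
    ultimately show False
      using finite_subset[OF _ fin[of z], of "{n. ?V n = ?V m}"] by blast
  qed
  moreover have "open_cover Z (range ?V)"
    unfolding open_cover_def
  proof (intro conjI ballI subsetI)
    fix v assume "v \<in> range ?V"
    then show "openin Z v"
      using U F(1) unfolding open_cover_def by (blast intro: openin_Union)
  next
    fix z assume "z \<in> topspace Z"
    then have "{n. z \<notin> ?V n} \<noteq> UNIV"
      using fin[of z] infinite_UNIV_nat by metis
    then obtain n where "z \<in> ?V n"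
      by auto
    then show "z \<in> \<Union>(range ?V)"
      by (rule UnionI[OF rangeI])
  qed
  moreover have "finite {v \<in> range ?V. z \<notin> v}" if "z \<in> topspace Z" for z
    by (rule finite_subset[OF _ finite_imageI[OF fin[OF that], of ?V]]) auto
  ultimately show "\<exists>F. (\<forall>n. F n \<subseteq> U n \<and> finite (F n)) \<and> point_cofinite_cover Z (range (\<lambda>n. \<Union>(F n)))"
    using F(1,2) unfolding point_cofinite_cover_def by blast
qed

text \<open>Complete regularity gives for each \<open>z\<close> a function that vanishes at
  \<open>z\<close> and is 1 off a member of \<open>U\<close>. The Lindelof property leaves countably
  many of them, and \<open>\<phi>\<close> is 1 minus these.\<close>

lemma functional_refinement:
  assumes Z: "Lindelof_space Z" "completely_regular_space Z" and ne: "topspace Z \<noteq> {}"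
    and U: "open_cover Z U"
  obtains u :: "nat \<Rightarrow> 'a set" and \<phi> :: "nat \<Rightarrow> 'a \<Rightarrow> real"
  where "\<And>m. u m \<in> U" "\<And>m. continuous_map Z euclideanreal (\<phi> m)"
    "\<And>m z. z \<in> topspace Z \<Longrightarrow> \<phi> m z \<in> {0..1}"
    "\<And>m z. z \<in> topspace Z \<Longrightarrow> 0 < \<phi> m z \<Longrightarrow> z \<in> u m"
    "\<And>z. z \<in> topspace Z \<Longrightarrow> \<exists>m. 0 < \<phi> m z"
proof -
  have "\<exists>u f. u \<in> U \<and> continuous_map Z (top_of_set {0..1::real}) f \<and>
      (\<forall>x\<in>topspace Z. f x < 1 \<longrightarrow> x \<in> u) \<and> f z = 0" if z: "z \<in> topspace Z" for z
  proof -
    obtain u where u: "u \<in> U" "z \<in> u" "openin Z u"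
      using U z by (auto simp: open_cover_def)
    then obtain f where "continuous_map Z (top_of_set {0..1::real}) f" "f z = 0"
      "f ` (topspace Z - u) \<subseteq> {1}"
      using Z(2) z unfolding completely_regular_space_def
      by (metis Diff_iff closedin_diff closedin_topspace)
    then show ?thesis
      using u by (intro exI[of _ u] exI[of _ f]) fastforce
  qed
  then obtain u f where uf: "\<And>z. z \<in> topspace Z \<Longrightarrow> u z \<in> U"
    "\<And>z. z \<in> topspace Z \<Longrightarrow> continuous_map Z (top_of_set {0..1::real}) (f z)"
    "\<And>z x. z \<in> topspace Z \<Longrightarrow> x \<in> topspace Z \<Longrightarrow> f z x < 1 \<Longrightarrow> x \<in> u z"
    "\<And>z. z \<in> topspace Z \<Longrightarrow> f z z = 0"
    by metis
  have cont: "continuous_map Z euclideanreal (f z)" if "z \<in> topspace Z" for z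
    using uf(2)[OF that] by (simp add: continuous_map_in_subtopology)
  let ?W = "\<lambda>z. {x \<in> topspace Z. f z x \<in> {..<1}}"
  have "\<forall>w \<in> ?W ` topspace Z. openin Z w"
    using cont by (auto intro!: openin_continuous_map_preimage simp del: lessThan_iff)
  moreover have "topspace Z \<subseteq> \<Union>(?W ` topspace Z)"
    using uf(4) by auto
  ultimately obtain T where T: "countable T" "T \<subseteq> topspace Z" "topspace Z \<subseteq> \<Union>(?W ` T)"
    using Z(1) unfolding Lindelof_space_alt by (metis (no_types, lifting) countable_subset_image)
  have "T \<noteq> {}"
    using T(3) ne by auto
  \<comment> \<open>Non-emptiness of \<open>T\<close> keeps all values of \<open>t\<close> in
    \<open>T\<close>; a finite \<open>T\<close> is listed with repetitions.\<close>
  define t where "t = from_nat_into T"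
  have t: "t m \<in> topspace Z" for m
    using from_nat_into[OF \<open>T \<noteq> {}\<close>] T(2) unfolding t_def by blast
  show thesis
  proof (rule that[of "\<lambda>m. u (t m)" "\<lambda>m z. 1 - f (t m) z"])
    show "u (t m) \<in> U" for m
      using uf(1) t by blast
    show "continuous_map Z euclideanreal (\<lambda>z. 1 - f (t m) z)" for m
      using cont[OF t] by (intro continuous_map_diff) auto
    show "1 - f (t m) z \<in> {0..1}" if "z \<in> topspace Z" for m z
      using uf(2)[OF t] that by (fastforce simp: continuous_map_in_subtopology)
    show "z \<in> u (t m)" if "z \<in> topspace Z" "0 < 1 - f (t m) z" for m z
      using uf(3)[OF t] that by simp
    show "\<exists>m. 0 < 1 - f (t m) z" if z: "z \<in> topspace Z" for z
    proof -
      obtain s where "s \<in> T" "f s z < 1"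
        using T(3) z by blast
      then show ?thesis
        using from_nat_into_surj[OF T(1)] by (metis diff_gt_0_iff_gt t_def)
    qed
  qed
qed

lemma compact_unit_cube: "compact {h :: 'i::countable \<Rightarrow> real. \<forall>i. h i \<in> {0..1}}"
proof -
  have "compactin (product_topology (\<lambda>_ :: 'i. euclideanreal) UNIV) (UNIV \<rightarrow>\<^sub>E {0..1})"
    by (simp add: compactin_PiE)
  moreover have "(UNIV \<rightarrow>\<^sub>E {0..1}) = {h :: 'i \<Rightarrow> real. \<forall>i. h i \<in> {0..1}}"
    by auto
  ultimately show ?thesis
    by (simp add: euclidean_product_topology)
qed

text \<open>For each \<open>n\<close> finitely many \<open>V n m\<close> cover the compact
  \<open>C j\<close>. A bound at stage \<open>n\<close> that serves all \<open>C j\<close> with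
  \<open>j \<le> n\<close> serves a fixed \<open>C j\<close> from \<open>n = j\<close> on; the sum
  of the single bounds is such a bound.\<close>

lemma sigma_compact_Hurewicz_selection:
  fixes C :: "nat \<Rightarrow> 'b::topological_space set"
  assumes "\<And>j. compact (C j)" "\<And>n m. open (V n m)" "\<And>j n. C j \<subseteq> (\<Union>m. V n m)"
  shows "\<exists>N :: nat \<Rightarrow> nat. \<forall>j. \<forall>x\<in>C j. \<forall>\<^sub>F n in sequentially. x \<in> (\<Union>m\<le>N n. V n m)"
proof -
  have "\<exists>N. C j \<subseteq> (\<Union>m\<le>N. V n m)" for j n :: nat
  proof -
    obtain I where I: "finite I" "C j \<subseteq> (\<Union>m\<in>I. V n m)"
      using compactE_image[OF assms(1)[of j], of UNIV "V n"] assms(2,3) by metis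
    then obtain N where "I \<subseteq> {..N}"
      using finite_nat_iff_bounded_le by blast
    then show ?thesis
      using I(2) by (intro exI[of _ N]) blast
  qed
  then obtain N where N: "\<And>j n. C j \<subseteq> (\<Union>m\<le>N j n. V n m)"
    by metis
  let ?N = "\<lambda>n. \<Sum>j\<le>n. N j n"
  have "\<forall>\<^sub>F n in sequentially. x \<in> (\<Union>m\<le>?N n. V n m)" if "x \<in> C j" for x j
    using eventually_ge_at_top[of j]
  proof eventually_elim
    case (elim n)
    then have "N j n \<le> ?N n"
      by (intro member_le_sum) auto
    then show ?case
      using N[of j n] that by fastforce
  qed
  then show ?thesis
    by (intro exI[of _ ?N]) blast
qed

lemma CH_Hurewicz_space:
  fixes Z :: "'z topology"
  assumes "CH" "regular_space Z" "Lindelof_space Z"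
    and prod: "\<And>Y :: (nat \<times> nat \<Rightarrow> real) topology. Lindelof_space Y \<Longrightarrow> Lindelof_space (prod_topology Z Y)"
  shows "Hurewicz_space Z"
proof (rule Hurewicz_spaceI)
  fix U :: "nat \<Rightarrow> 'z set set"
  assume U: "\<And>n. open_cover Z (U n)" "\<And>n. \<not> has_finite_subcover Z (U n)"
  have ne: "topspace Z \<noteq> {}"
    using U(2)[of 0] by (auto simp: has_finite_subcover_def)
  have cr: "completely_regular_space Z"
    using assms(2,3) regular_Lindelof_imp_normal_space normal_imp_completely_regular_space by blast
  have "\<exists>u \<phi>. (\<forall>m. u m \<in> U n) \<and> (\<forall>m. continuous_map Z euclideanreal (\<phi> m)) \<and>
    (\<forall>m. \<forall>z\<in>topspace Z. \<phi> m z \<in> {0..1} \<and> (0 < \<phi> m z \<longrightarrow> z \<in> u m)) \<and>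
    (\<forall>z\<in>topspace Z. \<exists>m::nat. 0 < (\<phi> m z :: real))" for n
    by (rule functional_refinement[OF assms(3) cr ne U(1)[of n]]) blast
  then obtain u \<phi> where u: "\<And>n m. u n m \<in> U n"
    and \<phi>: "\<And>n m. continuous_map Z euclideanreal (\<phi> n m)"
      "\<And>n m z. z \<in> topspace Z \<Longrightarrow> \<phi> n m z \<in> {0..1}"
      "\<And>n m z. z \<in> topspace Z \<Longrightarrow> 0 < \<phi> n m z \<Longrightarrow> z \<in> u n m"
      "\<And>n z. z \<in> topspace Z \<Longrightarrow> \<exists>m::nat. 0 < (\<phi> n m z :: real)"
    by metis
  \<comment> \<open>Indexing by pairs treats all covers in one map, so the compact pieces of
    \<open>?M\<close> do not depend on \<open>n\<close>.\<close>
  define f where "f z = (\<lambda>(n, m). \<phi> n m z)" for z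
  let ?M = "f ` topspace Z"
  let ?K = "{h :: nat \<times> nat \<Rightarrow> real. \<forall>i. h i \<in> {0..1}}"
  have f: "continuous_map Z (top_of_set ?M) f"
  proof -
    have "continuous_map Z euclidean f"
      unfolding euclidean_product_topology[symmetric] continuous_map_componentwise_UNIV
      using \<phi>(1) by (auto simp: f_def)
    then show ?thesis
      by (simp add: continuous_map_in_subtopology)
  qed
  \<comment> \<open>The product with \<open>?M\<close> is a continuous image of the product with
    \<open>Z\<close>.\<close>
  have "Lindelof_space (prod_topology (top_of_set ?M) Y)"
    if "Lindelof_space Y" for Y :: "(nat \<times> nat \<Rightarrow> real) topology"
  proof (rule Lindelof_space_continuous_map_image[OF prod[OF that]])
    show "continuous_map (prod_topology Z Y) (prod_topology (top_of_set ?M) Y) (\<lambda>(z, y). (f z, y))"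
      using f by (auto simp: case_prod_unfold continuous_map_fst continuous_map_snd comp_def
          intro!: continuous_map_pairedI continuous_map_compose[OF continuous_map_fst, unfolded comp_def])
    show "(\<lambda>(z, y). (f z, y)) ` topspace (prod_topology Z Y) = topspace (prod_topology (top_of_set ?M) Y)"
      by force
  qed
  moreover have "?M \<subseteq> ?K"
    using \<phi>(2) by (auto simp: f_def)
  ultimately have "\<exists>\<D>. countable \<D> \<and> (\<forall>C\<in>\<D>. compact C) \<and> \<Union>\<D> = ?M"
    by (intro CH_sigma_compact[OF \<open>CH\<close> compact_unit_cube])
  then obtain \<D> where D: "countable \<D>" "\<And>C. C \<in> \<D> \<Longrightarrow> compact C" "\<Union>\<D> = ?M"
    by metis
  define C where "C = from_nat_into \<D>"
  have "\<D> \<noteq> {}"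
    using D(3) ne by auto
  then have C: "range C = \<D>"
    using D(1) by (simp add: C_def)
  \<comment> \<open>Positivity of coordinate \<open>(n, m)\<close> pulls back along \<open>f\<close>
    into \<open>u n m\<close>, so choosing half-spaces amounts to choosing members of
    \<open>U n\<close>.\<close>
  have "C j \<subseteq> (\<Union>m. {h. 0 < h (n, m)})" for j n
  proof
    fix h assume "h \<in> C j"
    then have "h \<in> ?M"
      using C D(3) by blast
    then show "h \<in> (\<Union>m. {h. 0 < h (n, m)})"
      using \<phi>(4)[of _ n] by (auto simp: f_def)
  qed
  moreover have "open {h :: nat \<times> nat \<Rightarrow> real. 0 < h (n, m)}" for n m
    by (intro open_Collect_less continuous_on_const continuous_on_product_coordinates)
  moreover have "compact (C j)" for j
    using C D(2) by blast
  ultimately have "\<exists>N :: nat \<Rightarrow> nat. \<forall>j. \<forall>h\<in>C j.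
      \<forall>\<^sub>F n in sequentially. h \<in> (\<Union>m\<le>N n. {h. 0 < h (n, m)})"
    by (intro sigma_compact_Hurewicz_selection)
  then obtain N :: "nat \<Rightarrow> nat" where
    N: "\<forall>j. \<forall>h\<in>C j. \<forall>\<^sub>F n in sequentially. h \<in> (\<Union>m\<le>N n. {h. 0 < h (n, m)})" ..
  let ?F = "\<lambda>n. u n ` {..N n}"
  have "\<forall>\<^sub>F n in sequentially. z \<in> \<Union>(?F n)" if z: "z \<in> topspace Z" for z
  proof -
    obtain j where "f z \<in> C j"
      using C D(3) z by blast
    from bspec[OF spec[OF N] this] show ?thesis
      by eventually_elim (use \<phi>(3)[OF z] in \<open>auto simp: f_def\<close>)
  qed
  then show "\<exists>F. (\<forall>n. F n \<subseteq> U n \<and> finite (F n)) \<and>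
      (\<forall>z\<in>topspace Z. \<forall>\<^sub>F n in sequentially. z \<in> \<Union>(F n))"
    using u by (intro exI[of _ ?F]) auto
qed

theorem theorem2p8:
  fixes X :: "'a topology"
  assumes "CH"
    and "productively_Lindelof TYPE('a set) X"
    and "sequential_space X"
    and "T3_space X"
  shows "\<forall>k::nat. k \<ge> 1 \<longrightarrow> Hurewicz_space (power_space X k)"
proof (intro allI impI)
  fix k :: nat
  let ?Z = "power_space X k"
  show "Hurewicz_space ?Z"
  proof (cases "finite (UNIV :: 'a set)")
    \<comment> \<open>All powers are finite, hence compact, and no open cover lacks a finite
      subcover.\<close>
    case True
    then have "finite (topspace X)"
      by (rule rev_finite_subset) simp
    then have "finite (topspace ?Z)"
      by (auto simp: power_space_def intro: finite_PiE)
    then have "compact_space ?Z"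
      by (simp add: compact_space_def finite_imp_compactin)
    then have "has_finite_subcover ?Z U" if "open_cover ?Z U" for U
      using that unfolding compact_space_alt open_cover_def has_finite_subcover_def by metis
    then show ?thesis
      by (auto simp: Hurewicz_space_def)
  next
    case False
    \<comment> \<open>The cube type has at most continuum many points, and an infinite
      \<open>'a\<close> has at least continuum many subsets. Every space on the cube type is thus
      small enough to be tested.\<close>
    have "(UNIV :: (nat \<times> nat \<Rightarrow> real) set) \<lesssim> (UNIV :: 'a set set)"
    proof -
      have "(UNIV :: nat set) \<lesssim> (UNIV :: 'a set)"
        using False by (simp add: infinite_le_lepoll)
      then obtain e :: "nat \<Rightarrow> 'a" where "inj e"
        by (auto simp: lepoll_def)
      then have "(UNIV :: nat set set) \<lesssim> (UNIV :: 'a set set)"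
        unfolding lepoll_def by (intro exI[of _ "(`) e"]) (auto simp: inj_image_eq_iff intro: injI)
      then show ?thesis
        by (meson UNIV_lepoll_real eqpoll_imp_lepoll eqpoll_sym lepoll_trans nat_sets_eqpoll_reals)
    qed
    then have prod: "Lindelof_space (prod_topology ?Z Y)"
      if "Lindelof_space Y" for Y :: "(nat \<times> nat \<Rightarrow> real) topology"
      using Lindelof_prod_power_space[OF assms(2) False that]
        lepoll_trans[OF subset_imp_lepoll[OF subset_UNIV]] by blast
    have "Lindelof_space ?Z"
    proof -
      \<comment> \<open>A one-point test space turns \<open>prod\<close> into the Lindelof property
        of \<open>?Z\<close> itself.\<close>
      let ?Y = "discrete_topology {\<lambda>_ :: nat \<times> nat. 0 :: real}"
      have "Lindelof_space (prod_topology ?Z ?Y)"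
        by (intro prod countable_imp_Lindelof_space) simp
      then show ?thesis
        by (rule Lindelof_space_continuous_map_image[OF _ continuous_map_fst]) force
    qed
    moreover have "regular_space ?Z"
      using assms(4) unfolding power_space_def T3_space_def regular_space_product_topology by blast
    ultimately show ?thesis
      using CH_Hurewicz_space[OF \<open>CH\<close>] prod by blast
  qed
qed

end
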